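(* Let $\mathcal{X} \in \mathbb{R}^{m \times ps}$ and let $\bar{\mathcal{Q}}, \bar{\mathcal{R}}$ be the factors computed by BCGS-PIP+ applied to $(\mathcal{X},\mathrm{IO})$, with intermediate computed quantities $\bar{\mathcal{U}}, \bar{\mathcal{S}}, \bar{\mathcal{T}}$. Suppose that for constants $\delta_{US}, \omega_U, \delta_{QT}, \omega_Q, \delta_{TS} \in (0,1)$, $$\bar{\mathcal{U}}\bar{\mathcal{S}} = \mathcal{X} + \Delta\mathcal{D}_{US},\quad \|\Delta\mathcal{D}_{US}\| \le \delta_{US}\|\mathcal{X}\|;$$ $$\|I - \bar{\mathcal{U}}^T\bar{\mathcal{U}}\| \le \omega_U\,\kappa^2(\mathcal{X});$$ $$\bar{\mathcal{Q}}\bar{\mathcal{T}} = \bar{\mathcal{U}} + \Delta\mathcal{D}_{QT},\quad \|\Delta\mathcal{D}_{QT}\| \le \delta_{QT}\|\bar{\mathcal{U}}\|;$$ $$\|I - \bar{\mathcal{Q}}^T\bar{\mathcal{Q}}\| \le \omega_Q\,\kappa^2(\bar{\mathcal{U}});$$ $$\bar{\mathcal{R}} = \bar{\mathcal{T}}\bar{\mathcal{S}} + \Delta\mathcal{D}_{TS},\quad \|\Delta\mathcal{D}_{TS}\| \le \delta_{TS}\|\bar{\mathcal{T}}\|\,\|\bar{\mathcal{S}}\|,$$ and that $\omega_U\kappa^2(\mathcal{X}) \le \frac12$ and $\omega_Q \le \frac16$. Then $$\|I - \bar{\mathcal{Q}}^T\bar{\mathcal{Q}}\| \le 3\,\omega_Q,$$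 $$\bar{\mathcal{Q}}\bar{\mathcal{R}} = \mathcal{X} + \Delta\mathcal{D},\quad \|\Delta\mathcal{D}\| \le \bigl(\delta_{US} + \sqrt6\,\delta_{QT} + 9\,\delta_{TS}\bigr)\|\mathcal{X}\|.$$
   Context: $\|\cdot\|$ is the spectral norm; $\kappa$ is the 2-norm condition number (ratio of largest to smallest singular value). Bars denote quantities computed in floating-point arithmetic. First-order convention: the small constants $\delta_*,\omega_*$ are assumed much smaller than $1$ and "quadratic" terms, i.e. those resulting from products of such constants, are dropped; the residual inequality is understood in this sense. $\mathcal{X} = [X_1\ \cdots\ X_p]$ with blocks $X_k \in \mathbb{R}^{m\times s}$. For $\mathcal{R}\in\mathbb{R}^{ps\times ps}$ with $s\times s$ blocks $R_{ij}$, $\mathcal{R}_{1:k-1,k} = [R_{1,k};\dots;R_{k-1,k}]$; $\mathcal{Q}_k = [Q_1\ \cdots\ Q_k]$. $\mathrm{IO}$ is a routine which, given $X\in\mathbb{R}^{m\times s}$, returns $Q\in\mathbb{R}^{m\times s}$ and upper triangular $R\in\mathbb{R}^{s\times s}$ of a QR factorization $X=QR$. $\mathrm{chol}(A)$ is the upper triangular $R$ with $R^TR=A$. Algorithm $[\mathcal{Q},\mathcal{R}] = \text{BCGS-PIP}(\mathcal{X}, \mathrm{IO})$: set $[Q_1,R_{11}] = \mathrm{IO}(X_1)$; for $k=2,\dots,p$: $\mathcal{R}_{1:k-1,k} = \mathcal{Q}_{k-1}^T X_k$, $P_k = X_k^T X_k$; $R_{kk} = \mathrm{chol}(P_k - \mathcal{R}_{1:k-1,k}^T\mathcal{R}_{1:k-1,k})$;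 $V_k = X_k - \mathcal{Q}_{k-1}\mathcal{R}_{1:k-1,k}$; $Q_k = V_k R_{kk}^{-1}$. Algorithm $[\mathcal{Q},\mathcal{R}] = \text{BCGS-PIP+}(\mathcal{X}, \mathrm{IO})$: $[\mathcal{U},\mathcal{S}] = \text{BCGS-PIP}(\mathcal{X},\mathrm{IO})$; $[\mathcal{Q},\mathcal{T}] = \text{BCGS-PIP}(\mathcal{U},\mathrm{IO})$; $\mathcal{R} = \mathcal{T}\mathcal{S}$. Here $\mathcal{U},\mathcal{Q}\in\mathbb{R}^{m\times ps}$ and $\mathcal{S},\mathcal{T},\mathcal{R}\in\mathbb{R}^{ps\times ps}$. *)

theory Defs
  imports
    Complex_Main
    "HOL-Library.Extended_Real"
    "Jordan_Normal_Form.Char_Poly"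
    "Jordan_Normal_Form.DL_Submatrix"
begin

definition vnorm :: "real vec \<Rightarrow> real" where
  "vnorm v = sqrt (v \<bullet> v)"

definition spectral_norm :: "real mat \<Rightarrow> real" where
  "spectral_norm A = (SUP v \<in> {v \<in> carrier_vec (dim_col A). vnorm v = 1}. vnorm (A *\<^sub>v v))"

definition singular_values :: "real mat \<Rightarrow> real set" where
  "singular_values A = {\<sigma>. 0 \<le> \<sigma> \<and> eigenvalue (A\<^sup>T * A) (\<sigma>\<^sup>2)}"

(* The value is extended real so that a matrix without full column rank has condition number
   infinity; a real-valued quotient would give 0 there. *)
definition kappa :: "real mat \<Rightarrow> ereal" where
  "kappa A = (if Min (singular_values A) = 0 then \<infinity>
              else ereal (Max (singular_values A) / Min (singular_values A)))"

(* A floating-point arithmetic is given by its matrix kernels, as relations between inputs and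
   admissible computed outputs, so that neither a rounding model nor an order of summation is
   fixed, different calls may round differently, and a breakdown is the absence of an output:
     fl_mult A B C        C is a computed A * B
     fl_minus_mult A B C D  D is a computed A - B * C
     fl_chol A R          R is a computed upper triangular Cholesky factor, R^T * R = A
     fl_rdiv V R Q        Q is a computed V * R^(-1) *)
record fl_arith =
  fl_mult :: "real mat \<Rightarrow> real mat \<Rightarrow> real mat \<Rightarrow> bool"
  fl_minus_mult :: "real mat \<Rightarrow> real mat \<Rightarrow> real mat \<Rightarrow> real mat \<Rightarrow> bool"
  fl_chol :: "real mat \<Rightarrow> real mat \<Rightarrow> bool"
  fl_rdiv :: "real mat \<Rightarrow> real mat \<Rightarrow> real mat \<Rightarrow> bool"

(* IO X Q R: the routine may return Q and R as computed factors of a QR factorization of X *)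
type_synonym intraortho = "real mat \<Rightarrow> real mat \<Rightarrow> real mat \<Rightarrow> bool"

(* The indices of the k-th block of size s, and of all blocks before it; blocks are numbered
   from 0. *)
definition blk :: "nat \<Rightarrow> nat \<Rightarrow> nat set" where
  "blk s k = {k * s..<(k + 1) * s}"

definition blks_before :: "nat \<Rightarrow> nat \<Rightarrow> nat set" where
  "blks_before s k = {..<k * s}"

(* Q and R are factors computed by BCGS-PIP from X in the arithmetic F. The condition
   upper_triangular R says that R is block upper triangular and that the diagonal blocks, which
   are returned by IO and by the Cholesky kernel, are upper triangular. *)
definition BCGS_PIP ::
  "fl_arith \<Rightarrow> intraortho \<Rightarrow> nat \<Rightarrow> nat \<Rightarrow> nat \<Rightarrow> real mat \<Rightarrow> real mat \<Rightarrow> real mat \<Rightarrow> bool" where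
  "BCGS_PIP F IO m p s X Q R \<longleftrightarrow>
     X \<in> carrier_mat m (p * s) \<and> Q \<in> carrier_mat m (p * s) \<and>
     R \<in> carrier_mat (p * s) (p * s) \<and> upper_triangular R \<and>
     IO (submatrix X UNIV (blk s 0)) (submatrix Q UNIV (blk s 0)) (submatrix R (blk s 0) (blk s 0)) \<and>
     (\<forall>k \<in> {1..<p}.
        let X_k = submatrix X UNIV (blk s k);
            Q_k = submatrix Q UNIV (blk s k);
            Q_prev = submatrix Q UNIV (blks_before s k);
            R_col = submatrix R (blks_before s k) (blk s k);
            R_kk = submatrix R (blk s k) (blk s k)
        in \<exists>P \<in> carrier_mat s s. \<exists>W \<in> carrier_mat s s. \<exists>V \<in> carrier_mat m s.
             fl_mult F (Q_prev\<^sup>T) X_k R_col \<and>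
             fl_mult F (X_k\<^sup>T) X_k P \<and>
             fl_minus_mult F P (R_col\<^sup>T) R_col W \<and>
             fl_chol F W R_kk \<and>
             fl_minus_mult F X_k Q_prev R_col V \<and>
             fl_rdiv F V R_kk Q_k)"

definition BCGS_PIP_plus ::
  "fl_arith \<Rightarrow> intraortho \<Rightarrow> nat \<Rightarrow> nat \<Rightarrow> nat \<Rightarrow> real mat \<Rightarrow>
     real mat \<Rightarrow> real mat \<Rightarrow> real mat \<Rightarrow> real mat \<Rightarrow> real mat \<Rightarrow> bool" where
  "BCGS_PIP_plus F IO m p s X U S Q T R \<longleftrightarrow>
     BCGS_PIP F IO m p s X U S \<and>
     BCGS_PIP F IO m p s U Q T \<and>
     R \<in> carrier_mat (p * s) (p * s) \<and> fl_mult F T S R"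

end

theory Submission
  imports
    Defs
    "HOL-Analysis.L2_Norm"
    "Jordan_Normal_Form.Spectral_Radius"
begin

text \<open>
  The bounds \<open>\<omega>\<^sub>U \<kappa>\<^sup>2(X) \<le> 1/2\<close> and \<open>\<omega>\<^sub>Q \<le> 1/6\<close> make \<open>U\<close> and then \<open>Q\<close> nearly orthonormal: if
  \<open>\<parallel>I - A\<^sup>TA\<parallel> \<le> 1/2\<close>, all squared singular values of \<open>A\<close> lie in \<open>[1/2, 3/2]\<close>, so
  \<open>\<kappa>\<^sup>2(A) \<le> 3\<close>. Hence \<open>\<parallel>I - Q\<^sup>TQ\<parallel> \<le> 3 \<omega>\<^sub>Q \<le> 1/2\<close>. For the residual,
  \<open>QR - X = D\<^sub>U\<^sub>S + D\<^sub>Q\<^sub>T S + Q D\<^sub>T\<^sub>S\<close>, where \<open>\<parallel>S\<parallel> \<le> \<surd>2 (1 + \<delta>\<^sub>U\<^sub>S) \<parallel>X\<parallel>\<close> and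
  \<open>\<parallel>T\<parallel> \<le> \<surd>3 (1 + \<delta>\<^sub>Q\<^sub>T)\<close> because \<open>U\<close> and \<open>Q\<close> shrink lengths by at most the factor
  \<open>1/\<surd>2\<close>. The linear terms are \<open>\<delta>\<^sub>U\<^sub>S + \<surd>3 \<delta>\<^sub>Q\<^sub>T + 3 \<delta>\<^sub>T\<^sub>S\<close>, and the quadratic ones are absorbed
  by the constant 9.
\<close>

section \<open>The Euclidean norm, with its inequalities taken from \<open>L2_set\<close>\<close>

lemma vnorm_L2_set: "vnorm v = L2_set (($) v) {0..<dim_vec v}"
  by (simp add: vnorm_def L2_set_def scalar_prod_def power2_eq_square)

lemma vnorm_nonneg [simp]: "0 \<le> vnorm v"
  by (simp add: vnorm_L2_set)

lemma vnorm_sq: "(vnorm v)\<^sup>2 = v \<bullet> v"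
  by (simp add: vnorm_L2_set L2_set_def scalar_prod_def power2_eq_square sum_nonneg)

lemma vnorm_eq_0_iff: "v \<in> carrier_vec n \<Longrightarrow> vnorm v = 0 \<longleftrightarrow> v = 0\<^sub>v n"
  by (auto simp: vnorm_L2_set L2_set_eq_0_iff)

lemma vnorm_smult: "vnorm (c \<cdot>\<^sub>v v) = \<bar>c\<bar> * vnorm v"
proof -
  have "(c \<cdot>\<^sub>v v) \<bullet> (c \<cdot>\<^sub>v v) = c\<^sup>2 * (v \<bullet> v)"
    by (simp add: power2_eq_square)
  then show ?thesis
    by (simp add: vnorm_def real_sqrt_mult)
qed

lemma vnorm_triangle:
  assumes "v \<in> carrier_vec n" "w \<in> carrier_vec n"
  shows "vnorm (v + w) \<le> vnorm v + vnorm w"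
proof -
  have "vnorm (v + w) = L2_set (\<lambda>i. v $ i + w $ i) {0..<n}"
    using assms by (auto simp: vnorm_L2_set intro!: L2_set_cong)
  then show ?thesis
    using L2_set_triangle_ineq[of "($) v" "($) w" "{0..<n}"] assms by (simp add: vnorm_L2_set)
qed

lemma abs_scalar_prod_le:
  assumes "v \<in> carrier_vec n" "w \<in> carrier_vec n"
  shows "\<bar>v \<bullet> w\<bar> \<le> vnorm v * vnorm w"
proof -
  have "\<bar>v \<bullet> w\<bar> \<le> (\<Sum>i = 0..<n. \<bar>v $ i\<bar> * \<bar>w $ i\<bar>)"
    using assms sum_abs[of "\<lambda>i. v $ i * w $ i" "{0..<n}"]
    by (simp add: scalar_prod_def abs_mult)
  also have "\<dots> \<le> vnorm v * vnorm w"
    using L2_set_mult_ineq[of "($) v" "($) w" "{0..<n}"] assms by (simp add: vnorm_L2_set)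
  finally show ?thesis .
qed

section \<open>The spectral norm as an operator norm\<close>

lemma bdd_above_spectral_norm:
  "bdd_above ((\<lambda>v. vnorm (A *\<^sub>v v)) ` {v \<in> carrier_vec (dim_col A). vnorm v = 1})"
proof (rule bdd_aboveI2)
  fix v assume v: "v \<in> {v \<in> carrier_vec (dim_col A). vnorm v = 1}"
  \<comment> \<open>A crude bound suffices: only boundedness matters, since a real supremum
    dominates its members only for a bounded set. Each entry of the product is estimated by
    Cauchy-Schwarz.\<close>
  have "vnorm (A *\<^sub>v v) \<le> (\<Sum>i = 0..<dim_row A. \<bar>row A i \<bullet> v\<bar>)"
    using L2_set_le_sum_abs[of "($) (A *\<^sub>v v)" "{0..<dim_row A}"] by (simp add: vnorm_L2_set)
  also have "\<dots> \<le> (\<Sum>i = 0..<dim_row A. vnorm (row A i))"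
  proof (rule sum_mono)
    fix i
    show "\<bar>row A i \<bullet> v\<bar> \<le> vnorm (row A i)"
      using abs_scalar_prod_le[of "row A i" "dim_col A" v] v by simp
  qed
  finally show "vnorm (A *\<^sub>v v) \<le> (\<Sum>i = 0..<dim_row A. vnorm (row A i))" .
qed

lemma vnorm_mult_le:
  assumes A: "A \<in> carrier_mat m n" and v: "v \<in> carrier_vec n"
  shows "vnorm (A *\<^sub>v v) \<le> spectral_norm A * vnorm v"
proof (cases "v = 0\<^sub>v n")
  case True
  then have "A *\<^sub>v v = 0\<^sub>v m"
    using A by auto
  then show ?thesis
    using True vnorm_eq_0_iff[of "0\<^sub>v m" m] vnorm_eq_0_iff[of "0\<^sub>v n" n] by simp
next
  case False
  then have pos: "vnorm v > 0"
    using vnorm_eq_0_iff[OF v] vnorm_nonneg[of v] by linarith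
  define w where "w = (1 / vnorm v) \<cdot>\<^sub>v v"
  have w: "w \<in> {w \<in> carrier_vec (dim_col A). vnorm w = 1}"
    using A v pos by (simp add: w_def vnorm_smult)
  have "vnorm (A *\<^sub>v w) \<le> spectral_norm A"
    unfolding spectral_norm_def using w by (rule cSUP_upper[OF _ bdd_above_spectral_norm])
  moreover have "vnorm (A *\<^sub>v w) = vnorm (A *\<^sub>v v) / vnorm v"
    using pos by (simp add: w_def mult_mat_vec[OF A v] vnorm_smult)
  ultimately show ?thesis
    using pos by (simp add: divide_le_eq)
qed

text \<open>In dimension 0 there is no unit vector, and \<open>spectral_norm\<close> would be the
  supremum of the empty set. This is why \<open>n > 0\<close> accompanies the upper bounds and the
  nonnegativity of the norm.\<close>

lemma ex_unit_vector:
  assumes "n > 0"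
  obtains v where "v \<in> carrier_vec n" "vnorm v = 1"
proof
  show "unit_vec n 0 \<in> carrier_vec n"
    by simp
  show "vnorm (unit_vec n 0) = 1"
    using assms by (simp add: vnorm_def)
qed

lemma spectral_norm_leI:
  assumes "A \<in> carrier_mat m n" "n > 0"
    and "\<And>v. v \<in> carrier_vec n \<Longrightarrow> vnorm v = 1 \<Longrightarrow> vnorm (A *\<^sub>v v) \<le> c"
  shows "spectral_norm A \<le> c"
  unfolding spectral_norm_def
proof (rule cSUP_least)
  show "{v \<in> carrier_vec (dim_col A). vnorm v = 1} \<noteq> {}"
    using ex_unit_vector[OF \<open>n > 0\<close>] assms(1) by blast
qed (use assms in auto)

lemma spectral_norm_nonneg:
  assumes A: "A \<in> carrier_mat m n" and "n > 0"
  shows "0 \<le> spectral_norm A"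
proof -
  obtain v where v: "v \<in> carrier_vec n" "vnorm v = 1"
    using ex_unit_vector[OF \<open>n > 0\<close>] .
  then show ?thesis
    using order_trans[OF vnorm_nonneg vnorm_mult_le[OF A v(1)]] by simp
qed

section \<open>Gram matrices and near-isometries\<close>

lemma gram_mult_scalar_prod:
  fixes A :: "real mat"
  assumes A: "A \<in> carrier_mat m n" and v: "v \<in> carrier_vec n" "w \<in> carrier_vec n"
  shows "(A\<^sup>T * A *\<^sub>v v) \<bullet> w = (A *\<^sub>v v) \<bullet> (A *\<^sub>v w)"
proof -
  have "A\<^sup>T * A *\<^sub>v v = A\<^sup>T *\<^sub>v (A *\<^sub>v v)"
    by (rule assoc_mult_mat_vec[of _ n m _ n]) (use A v in auto)
  then show ?thesis
    using transpose_vec_mult_scalar[OF A v(2), of "A *\<^sub>v v"] A v by simp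
qed

text \<open>The difference of squared lengths is the quadratic form of
  \<open>1\<^sub>m n - A\<^sup>T * A\<close> at \<open>v\<close>, so Cauchy-Schwarz applies. Both
  the near-isometry bounds and the location of the singular values come from this estimate.\<close>

lemma gram_deviation:
  assumes A: "A \<in> carrier_mat m n" and v: "v \<in> carrier_vec n"
  shows "\<bar>(vnorm v)\<^sup>2 - (vnorm (A *\<^sub>v v))\<^sup>2\<bar> \<le> spectral_norm (1\<^sub>m n - A\<^sup>T * A) * (vnorm v)\<^sup>2"
proof -
  have E: "1\<^sub>m n - A\<^sup>T * A \<in> carrier_mat n n" and G: "A\<^sup>T * A \<in> carrier_mat n n"
    using A by auto
  have "(1\<^sub>m n - A\<^sup>T * A) *\<^sub>v v = v - A\<^sup>T * A *\<^sub>v v"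
    using minus_mult_distrib_mat_vec[OF one_carrier_mat G v] v by simp
  then have "((1\<^sub>m n - A\<^sup>T * A) *\<^sub>v v) \<bullet> v = (vnorm v)\<^sup>2 - (vnorm (A *\<^sub>v v))\<^sup>2"
    using minus_scalar_prod_distrib[of v n "A\<^sup>T * A *\<^sub>v v" v] G v gram_mult_scalar_prod[OF A v v]
    by (simp add: vnorm_sq)
  moreover have "\<bar>((1\<^sub>m n - A\<^sup>T * A) *\<^sub>v v) \<bullet> v\<bar> \<le> vnorm ((1\<^sub>m n - A\<^sup>T * A) *\<^sub>v v) * vnorm v"
    by (rule abs_scalar_prod_le) (use E v in auto)
  moreover have "\<dots> \<le> spectral_norm (1\<^sub>m n - A\<^sup>T * A) * vnorm v * vnorm v"
    by (rule mult_right_mono[OF vnorm_mult_le[OF E v]]) simp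
  ultimately show ?thesis
    by (simp add: power2_eq_square mult.assoc)
qed

text \<open>The squared length of \<open>A *\<^sub>v v\<close> lies between 1/2 and 3/2 of that of
  \<open>v\<close>. The upper half bounds the action of \<open>U\<close> and \<open>Q\<close>; the
  lower half lets them be cancelled from the products \<open>U * S\<close> and
  \<open>Q * T\<close>.\<close>

lemma
  assumes A: "A \<in> carrier_mat m n" and v: "v \<in> carrier_vec n"
    and half: "spectral_norm (1\<^sub>m n - A\<^sup>T * A) \<le> 1 / 2"
  shows near_isometry_upper: "vnorm (A *\<^sub>v v) \<le> sqrt (3 / 2) * vnorm v"
    and near_isometry_lower: "vnorm v \<le> sqrt 2 * vnorm (A *\<^sub>v v)"
proof -
  have dev: "\<bar>(vnorm v)\<^sup>2 - (vnorm (A *\<^sub>v v))\<^sup>2\<bar> \<le> 1 / 2 * (vnorm v)\<^sup>2"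
    using order_trans[OF gram_deviation[OF A v] mult_right_mono[OF half]] by simp
  have sq: "(vnorm (A *\<^sub>v v))\<^sup>2 \<le> 3 / 2 * (vnorm v)\<^sup>2" "(vnorm v)\<^sup>2 \<le> 2 * (vnorm (A *\<^sub>v v))\<^sup>2"
    using dev unfolding abs_le_iff by linarith+
  show "vnorm (A *\<^sub>v v) \<le> sqrt (3 / 2) * vnorm v"
    by (rule power2_le_imp_le) (use sq in \<open>auto simp: power_mult_distrib\<close>)
  show "vnorm v \<le> sqrt 2 * vnorm (A *\<^sub>v v)"
    by (rule power2_le_imp_le) (use sq in \<open>auto simp: power_mult_distrib\<close>)
qed

text \<open>Serves twice: for \<open>S\<close> in \<open>U * S = X + D_US\<close> and for
  \<open>T\<close> in \<open>Q * T = U + D_QT\<close>. Since \<open>A\<close> may be rectangular, it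
  is removed not by an inverse but by its lower length bound, at the price of
  \<open>sqrt 2\<close>.\<close>

lemma spectral_norm_right_factor_le:
  assumes A: "A \<in> carrier_mat m n" and B: "B \<in> carrier_mat n k" and "k > 0"
    and Y: "Y \<in> carrier_mat m k" and E: "E \<in> carrier_mat m k"
    and half: "spectral_norm (1\<^sub>m n - A\<^sup>T * A) \<le> 1 / 2"
    and AB: "A * B = Y + E" and d: "spectral_norm E \<le> d * spectral_norm Y"
  shows "spectral_norm B \<le> sqrt 2 * (1 + d) * spectral_norm Y"
proof (rule spectral_norm_leI[OF B \<open>k > 0\<close>])
  fix v :: "real vec" assume v: "v \<in> carrier_vec k" "vnorm v = 1"
  have "vnorm (B *\<^sub>v v) \<le> sqrt 2 * vnorm (A *\<^sub>v (B *\<^sub>v v))"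
    by (rule near_isometry_lower[OF A _ half]) (use B v in auto)
  also have "A *\<^sub>v (B *\<^sub>v v) = Y *\<^sub>v v + E *\<^sub>v v"
    using assoc_mult_mat_vec[OF A B v(1)] add_mult_distrib_mat_vec[OF Y E v(1)] AB by simp
  also have "vnorm (Y *\<^sub>v v + E *\<^sub>v v) \<le> vnorm (Y *\<^sub>v v) + vnorm (E *\<^sub>v v)"
    by (rule vnorm_triangle[of _ m]) (use Y E v in auto)
  also have "\<dots> \<le> spectral_norm Y + d * spectral_norm Y"
    using vnorm_mult_le[OF Y v(1)] vnorm_mult_le[OF E v(1)] d v(2) by simp
  finally show "vnorm (B *\<^sub>v v) \<le> sqrt 2 * (1 + d) * spectral_norm Y"
    by (simp add: algebra_simps)
qed

section \<open>Real eigenvalues of real symmetric matrices\<close>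

lemma symmetric_real_eigenvalue_exists:
  fixes A :: "real mat"
  assumes A: "A \<in> carrier_mat n n" and n: "n > 0" and sym: "A\<^sup>T = A"
  shows "\<exists>k. eigenvalue A k"
proof -
  \<comment> \<open>Over the complex numbers an eigenpair always exists. The plan is to split its
    eigenvector into real and imaginary parts and to let symmetry force the eigenvalue to be
    real.\<close>
  define B where "B = map_mat complex_of_real A"
  have B: "B \<in> carrier_mat n n"
    using A by (simp add: B_def)
  obtain k z where "eigenvector B z k"
    using spectrum_non_empty[OF B n] by (auto simp: spectrum_def eigenvalue_def)
  then have z: "z \<in> carrier_vec n" "z \<noteq> 0\<^sub>v n" and Bz: "B *\<^sub>v z = k \<cdot>\<^sub>v z"
    using B by (auto simp: eigenvector_def)
  define x where "x = map_vec Re z"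
  define y where "y = map_vec Im z"
  have x: "x \<in> carrier_vec n" and y: "y \<in> carrier_vec n"
    using z by (auto simp: x_def y_def)
  have entry: "(\<Sum>j = 0..<n. complex_of_real (A $$ (i, j)) * z $ j) = k * z $ i" if "i < n" for i
  proof -
    have "(B *\<^sub>v z) $ i = (\<Sum>j = 0..<n. complex_of_real (A $$ (i, j)) * z $ j)"
      using that A z by (auto simp: B_def scalar_prod_def intro!: sum.cong)
    then show ?thesis
      using that z by (simp add: Bz)
  qed
  have Ax: "A *\<^sub>v x = Re k \<cdot>\<^sub>v x - Im k \<cdot>\<^sub>v y"
  proof (rule eq_vecI)
    fix i assume "i < dim_vec (Re k \<cdot>\<^sub>v x - Im k \<cdot>\<^sub>v y)"
    then have i: "i < n"
      using y by simp
    have "(A *\<^sub>v x) $ i = (\<Sum>j = 0..<n. A $$ (i, j) * Re (z $ j))"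
      using i A z by (auto simp: x_def scalar_prod_def intro!: sum.cong)
    also have "\<dots> = Re (k * z $ i)"
      by (simp flip: entry[OF i])
    finally show "(A *\<^sub>v x) $ i = (Re k \<cdot>\<^sub>v x - Im k \<cdot>\<^sub>v y) $ i"
      using i z by (simp add: x_def y_def)
  qed (use A y in auto)
  have Ay: "A *\<^sub>v y = Re k \<cdot>\<^sub>v y + Im k \<cdot>\<^sub>v x"
  proof (rule eq_vecI)
    fix i assume "i < dim_vec (Re k \<cdot>\<^sub>v y + Im k \<cdot>\<^sub>v x)"
    then have i: "i < n"
      using x by simp
    have "(A *\<^sub>v y) $ i = (\<Sum>j = 0..<n. A $$ (i, j) * Im (z $ j))"
      using i A z by (auto simp: y_def scalar_prod_def intro!: sum.cong)
    also have "\<dots> = Im (k * z $ i)"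
      by (simp flip: entry[OF i])
    finally show "(A *\<^sub>v y) $ i = (Re k \<cdot>\<^sub>v y + Im k \<cdot>\<^sub>v x) $ i"
      using i z by (simp add: x_def y_def)
  qed (use A x in auto)
  have nz: "x \<noteq> 0\<^sub>v n \<or> y \<noteq> 0\<^sub>v n"
  proof (rule ccontr)
    assume "\<not> (x \<noteq> 0\<^sub>v n \<or> y \<noteq> 0\<^sub>v n)"
    then have "Re (z $ i) = 0 \<and> Im (z $ i) = 0" if "i < n" for i
      using that z unfolding x_def y_def
      by (metis carrier_vecD index_map_vec(1) index_zero_vec(1))
    then show False
      using z by (auto simp: vec_eq_iff complex_eq_iff)
  qed
  \<comment> \<open>Moving \<open>A\<close> across the scalar product makes the terms with
    \<open>Re k\<close> cancel; what remains is \<open>Im k\<close> times a positive number.\<close>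
  have "(A *\<^sub>v x) \<bullet> y = x \<bullet> (A *\<^sub>v y)"
    using transpose_vec_mult_scalar[OF A y x] sym by simp
  moreover have "(A *\<^sub>v x) \<bullet> y = Re k * (x \<bullet> y) - Im k * (y \<bullet> y)"
    using x y minus_scalar_prod_distrib[of "Re k \<cdot>\<^sub>v x" n "Im k \<cdot>\<^sub>v y" y] by (simp add: Ax)
  moreover have "x \<bullet> (A *\<^sub>v y) = Re k * (x \<bullet> y) + Im k * (x \<bullet> x)"
    using x y scalar_prod_add_distrib[of x n "Re k \<cdot>\<^sub>v y" "Im k \<cdot>\<^sub>v x"] by (simp add: Ay)
  ultimately have "Im k * ((vnorm x)\<^sup>2 + (vnorm y)\<^sup>2) = 0"
    by (simp add: vnorm_sq algebra_simps)
  moreover have "(vnorm x)\<^sup>2 + (vnorm y)\<^sup>2 \<noteq> 0"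
    using nz vnorm_eq_0_iff[OF x] vnorm_eq_0_iff[OF y] by (simp add: sum_power2_eq_zero_iff)
  ultimately have "Im k = 0"
    by (metis mult_eq_0_iff)
  \<comment> \<open>With \<open>Im k = 0\<close> the two equations decouple, and whichever of
    \<open>x\<close>, \<open>y\<close> is nonzero is a real eigenvector.\<close>
  then have "A *\<^sub>v x = Re k \<cdot>\<^sub>v x" "A *\<^sub>v y = Re k \<cdot>\<^sub>v y"
    using x y by (auto simp: Ax Ay)
  then show ?thesis
    using nz x y A by (auto simp: eigenvalue_def eigenvector_def)
qed

section \<open>Singular values and the condition number\<close>

lemma gram_eigenvector_vnorm:
  assumes A: "A \<in> carrier_mat m n" and ev: "eigenvector (A\<^sup>T * A) v k"
  shows "(vnorm (A *\<^sub>v v))\<^sup>2 = k * (vnorm v)\<^sup>2" "v \<in> carrier_vec n" "0 < vnorm v"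
proof -
  show v: "v \<in> carrier_vec n"
    using ev A by (auto simp: eigenvector_def)
  have "v \<noteq> 0\<^sub>v n"
    using ev A by (auto simp: eigenvector_def)
  then show "0 < vnorm v"
    using vnorm_eq_0_iff[OF v] vnorm_nonneg[of v] by linarith
  show "(vnorm (A *\<^sub>v v))\<^sup>2 = k * (vnorm v)\<^sup>2"
    using gram_mult_scalar_prod[OF A v v] ev v by (simp add: eigenvector_def vnorm_sq)
qed

text \<open>Together with nonemptiness this makes \<open>Min\<close> and \<open>Max\<close> in
  \<open>kappa\<close> attained. A singular value is nonnegative, hence recovered from its square,
  and the squares lie in a finite spectrum.\<close>

lemma finite_singular_values:
  assumes A: "A \<in> carrier_mat m n"
  shows "finite (singular_values A)"
proof -
  have "finite (spectrum (A\<^sup>T * A))"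
    using card_finite_spectrum(1)[of "A\<^sup>T * A" n] A by auto
  moreover have "singular_values A \<subseteq> sqrt ` spectrum (A\<^sup>T * A)"
    by (force simp: singular_values_def spectrum_def)
  ultimately show ?thesis
    by (meson finite_imageI finite_subset)
qed

lemma singular_values_nonempty:
  assumes A: "A \<in> carrier_mat m n" and "n > 0"
  shows "singular_values A \<noteq> {}"
proof -
  have "(A\<^sup>T * A)\<^sup>T = A\<^sup>T * A"
    using transpose_mult[of "A\<^sup>T" n m A n] A by simp
  then obtain k v where ev: "eigenvector (A\<^sup>T * A) v k"
    using symmetric_real_eigenvalue_exists[of "A\<^sup>T * A" n] A \<open>n > 0\<close>
    by (auto simp: eigenvalue_def)
  \<comment> \<open>The product is the squared length of \<open>A *\<^sub>v v\<close>, so the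
    eigenvalue is nonnegative and has a real square root.\<close>
  have "0 \<le> k * (vnorm v)\<^sup>2"
    by (simp flip: gram_eigenvector_vnorm(1)[OF A ev])
  then have "0 \<le> k"
    using gram_eigenvector_vnorm(3)[OF A ev] by (simp add: zero_le_mult_iff)
  then have "sqrt k \<in> singular_values A"
    using ev by (auto simp: singular_values_def eigenvalue_def)
  then show ?thesis
    by blast
qed

text \<open>On an eigenvector of the Gram matrix, \<open>gram_deviation\<close> becomes a statement
  about the eigenvalue after division by the squared length.\<close>

lemma singular_value_deviation:
  assumes A: "A \<in> carrier_mat m n" and "\<sigma> \<in> singular_values A"
  shows "\<bar>1 - \<sigma>\<^sup>2\<bar> \<le> spectral_norm (1\<^sub>m n - A\<^sup>T * A)"
proof -
  obtain v where ev: "eigenvector (A\<^sup>T * A) v (\<sigma>\<^sup>2)"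
    using assms by (auto simp: singular_values_def eigenvalue_def)
  note gv = gram_eigenvector_vnorm[OF A ev]
  have "\<bar>1 - \<sigma>\<^sup>2\<bar> * (vnorm v)\<^sup>2 = \<bar>(vnorm v)\<^sup>2 - (vnorm (A *\<^sub>v v))\<^sup>2\<bar>"
    using abs_mult[of "1 - \<sigma>\<^sup>2" "(vnorm v)\<^sup>2"] by (simp add: gv(1) left_diff_distrib)
  also have "\<dots> \<le> spectral_norm (1\<^sub>m n - A\<^sup>T * A) * (vnorm v)\<^sup>2"
    by (rule gram_deviation[OF A gv(2)])
  finally show ?thesis
    using gv(3) by simp
qed

lemma kappa_sq_le_3:
  assumes A: "A \<in> carrier_mat m n" and n: "n > 0"
    and half: "spectral_norm (1\<^sub>m n - A\<^sup>T * A) \<le> 1 / 2"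
  shows "(kappa A)\<^sup>2 \<le> 3"
proof -
  let ?a = "Min (singular_values A)" and ?b = "Max (singular_values A)"
  have "?a \<in> singular_values A" "?b \<in> singular_values A"
    using finite_singular_values[OF A] singular_values_nonempty[OF A n] by auto
  then have a: "1 / 2 \<le> ?a\<^sup>2" and b: "?b\<^sup>2 \<le> 3 / 2"
    using singular_value_deviation[OF A] half by fastforce+
  \<comment> \<open>This excludes the infinite branch of \<open>kappa\<close>; the finite quotient
    then has square at most (3/2) / (1/2) = 3.\<close>
  have "?a \<noteq> 0"
    using a by auto
  moreover have "(?b / ?a)\<^sup>2 \<le> 3"
    using a b by (simp add: power_divide divide_le_eq)
  ultimately show ?thesis
    by (simp add: kappa_def)
qed

text \<open>The left side is the coefficient that the residual estimate produces, with
  \<open>a\<close>, \<open>b\<close>, \<open>c\<close> for \<open>\<delta>_US\<close>,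
  \<open>\<delta>_QT\<close>, \<open>\<delta>_TS\<close>. Its linear part is dominated since 3 is
  below 6 and below 9; the mixed products are paid for by the cross terms of the square, whose
  coefficient 18 leaves ample room.\<close>

lemma residual_coefficient_le:
  fixes a b c :: real
  assumes a: "0 \<le> a" "a \<le> 1" and b: "0 \<le> b" and c: "0 \<le> c"
  shows "a + sqrt 3 * (b * (1 + a)) + 3 * (c * (1 + b) * (1 + a))
    \<le> a + sqrt 6 * b + 9 * c + 9 * (a + b + c)\<^sup>2"
proof -
  have "sqrt 3 \<le> 2"
    by (rule real_le_lsqrt) auto
  then have "sqrt 3 * (b * a) \<le> 2 * (b * a)"
    by (rule mult_right_mono) (use a b in simp)
  moreover have "sqrt 3 * b \<le> sqrt 6 * b"
    using b by (simp add: mult_right_mono)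
  \<comment> \<open>The only cubic term becomes quadratic by \<open>a \<le> 1\<close>.\<close>
  moreover have "c * (b * a) \<le> c * b"
    using a b c mult_left_mono[of "b * a" b c] mult_left_le[of a b] by (simp add: mult.commute)
  moreover have "0 \<le> b * a" "0 \<le> c * a" "0 \<le> c * b" "0 \<le> a\<^sup>2" "0 \<le> b\<^sup>2" "0 \<le> c\<^sup>2"
    using a b c by auto
  moreover have "(a + b + c)\<^sup>2 = a\<^sup>2 + b\<^sup>2 + c\<^sup>2 + 2 * (b * a) + 2 * (c * a) + 2 * (c * b)"
    by (simp add: power2_eq_square algebra_simps)
  moreover have "a + sqrt 3 * (b * (1 + a)) + 3 * (c * (1 + b) * (1 + a))
    = a + sqrt 3 * b + sqrt 3 * (b * a) + 3 * c + 3 * (c * b) + 3 * (c * a) + 3 * (c * (b * a))"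
    by (simp add: algebra_simps)
  ultimately show ?thesis
    using c by linarith
qed

section \<open>Orthogonality and residual of the computed factors\<close>

theorem theorem1:
  shows "\<exists>C :: real. \<forall>(F :: fl_arith) (IO :: intraortho) (m :: nat) (p :: nat) (s :: nat)
      (X :: real mat) (U :: real mat) (S :: real mat) (Q :: real mat) (T :: real mat) (R :: real mat)
      (D_US :: real mat) (D_QT :: real mat) (D_TS :: real mat)
      (\<delta>_US :: real) (\<omega>_U :: real) (\<delta>_QT :: real) (\<omega>_Q :: real) (\<delta>_TS :: real).
    0 < m \<and> 0 < p \<and> 0 < s \<and>
    BCGS_PIP_plus F IO m p s X U S Q T R \<and>
    \<delta>_US \<in> {0<..<1} \<and> \<omega>_U \<in> {0<..<1} \<and> \<delta>_QT \<in> {0<..<1} \<and> \<omega>_Q \<in> {0<..<1} \<and> \<delta>_TS \<in> {0<..<1} \<and>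
    D_US \<in> carrier_mat m (p * s) \<and> U * S = X + D_US \<and>
    spectral_norm D_US \<le> \<delta>_US * spectral_norm X \<and>
    ereal (spectral_norm (1\<^sub>m (p * s) - U\<^sup>T * U)) \<le> ereal \<omega>_U * (kappa X)\<^sup>2 \<and>
    D_QT \<in> carrier_mat m (p * s) \<and> Q * T = U + D_QT \<and>
    spectral_norm D_QT \<le> \<delta>_QT * spectral_norm U \<and>
    ereal (spectral_norm (1\<^sub>m (p * s) - Q\<^sup>T * Q)) \<le> ereal \<omega>_Q * (kappa U)\<^sup>2 \<and>
    D_TS \<in> carrier_mat (p * s) (p * s) \<and> R = T * S + D_TS \<and>
    spectral_norm D_TS \<le> \<delta>_TS * spectral_norm T * spectral_norm S \<and>
    ereal \<omega>_U * (kappa X)\<^sup>2 \<le> ereal (1 / 2) \<and> \<omega>_Q \<le> 1 / 6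
    \<longrightarrow>
    spectral_norm (1\<^sub>m (p * s) - Q\<^sup>T * Q) \<le> 3 * \<omega>_Q \<and>
    (\<exists>D \<in> carrier_mat m (p * s). Q * R = X + D \<and>
       spectral_norm D \<le> (\<delta>_US + sqrt 6 * \<delta>_QT + 9 * \<delta>_TS
                             + C * (\<delta>_US + \<delta>_QT + \<delta>_TS)\<^sup>2) * spectral_norm X)"
\<comment> \<open>The witness is the coefficient of the square in
  \<open>residual_coefficient_le\<close>. Being chosen before all dimensions and data, it expresses
  the first-order convention by an explicit quadratic remainder.\<close>
proof (rule exI[of _ 9], intro allI impI, elim conjE)
  fix F IO m p s X U S Q T R D_US D_QT D_TS
  fix \<delta>_US \<omega>_U \<delta>_QT \<omega>_Q \<delta>_TS :: real
  assume "0 < p" "0 < s" and alg: "BCGS_PIP_plus F IO m p s X U S Q T R"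
    and \<delta>_US: "\<delta>_US \<in> {0<..<1}" and \<delta>_QT: "\<delta>_QT \<in> {0<..<1}" and \<omega>_Q: "\<omega>_Q \<in> {0<..<1}"
    and \<delta>_TS: "\<delta>_TS \<in> {0<..<1}"
    and D_US: "D_US \<in> carrier_mat m (p * s)" and US: "U * S = X + D_US"
    and D_US_le: "spectral_norm D_US \<le> \<delta>_US * spectral_norm X"
    and U_le: "ereal (spectral_norm (1\<^sub>m (p * s) - U\<^sup>T * U)) \<le> ereal \<omega>_U * (kappa X)\<^sup>2"
    and D_QT: "D_QT \<in> carrier_mat m (p * s)" and QT: "Q * T = U + D_QT"
    and D_QT_le: "spectral_norm D_QT \<le> \<delta>_QT * spectral_norm U"
    and Q_le: "ereal (spectral_norm (1\<^sub>m (p * s) - Q\<^sup>T * Q)) \<le> ereal \<omega>_Q * (kappa U)\<^sup>2"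
    and D_TS: "D_TS \<in> carrier_mat (p * s) (p * s)" and R: "R = T * S + D_TS"
    and D_TS_le: "spectral_norm D_TS \<le> \<delta>_TS * spectral_norm T * spectral_norm S"
    and \<omega>_U_half: "ereal \<omega>_U * (kappa X)\<^sup>2 \<le> ereal (1 / 2)" and "\<omega>_Q \<le> 1 / 6"
  define n where "n = p * s"
  have n: "n > 0"
    using \<open>0 < p\<close> \<open>0 < s\<close> by (simp add: n_def)
  have X: "X \<in> carrier_mat m n" and U: "U \<in> carrier_mat m n" and S: "S \<in> carrier_mat n n"
    and Q: "Q \<in> carrier_mat m n" and T: "T \<in> carrier_mat n n"
    using alg by (auto simp: BCGS_PIP_plus_def BCGS_PIP_def n_def)
  note D_US = D_US[folded n_def] and D_QT = D_QT[folded n_def] and D_TS = D_TS[folded n_def]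
  have U_half: "spectral_norm (1\<^sub>m n - U\<^sup>T * U) \<le> 1 / 2"
    using order_trans[OF U_le \<omega>_U_half] by (simp add: n_def)
  have "ereal \<omega>_Q * (kappa U)\<^sup>2 \<le> ereal \<omega>_Q * 3"
    by (rule ereal_mult_left_mono[OF kappa_sq_le_3[OF U n U_half]]) (use \<omega>_Q in simp)
  then have Q_3: "spectral_norm (1\<^sub>m n - Q\<^sup>T * Q) \<le> 3 * \<omega>_Q"
    using order_trans[OF Q_le] by (fastforce simp: n_def mult.commute)
  \<comment> \<open>The orthogonality claim feeds back: three times 1/6 is 1/2, so the near-isometry
    bounds hold for \<open>Q\<close> as well.\<close>
  then have Q_half: "spectral_norm (1\<^sub>m n - Q\<^sup>T * Q) \<le> 1 / 2"
    using \<open>\<omega>_Q \<le> 1 / 6\<close> by simp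

  define x where "x = spectral_norm X"
  have x: "0 \<le> x"
    unfolding x_def by (rule spectral_norm_nonneg[OF X n])
  have U_norm: "spectral_norm U \<le> sqrt (3 / 2)"
    by (rule spectral_norm_leI[OF U n]) (use near_isometry_upper[OF U _ U_half] in fastforce)
  have S_norm: "spectral_norm S \<le> sqrt 2 * (1 + \<delta>_US) * x"
    unfolding x_def by (rule spectral_norm_right_factor_le[OF U S n X D_US U_half US D_US_le])
  \<comment> \<open>The bound is relative to \<open>U\<close>, whose norm is at most
    \<open>sqrt (3 / 2)\<close>; hence \<open>T\<close> is bounded independently of
    \<open>X\<close>, and the scale of \<open>X\<close> enters through \<open>S\<close>.\<close>
  have "spectral_norm T \<le> sqrt 2 * (1 + \<delta>_QT) * spectral_norm U"
    by (rule spectral_norm_right_factor_le[OF Q T n U D_QT Q_half QT D_QT_le])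
  also have "\<dots> \<le> sqrt 2 * (1 + \<delta>_QT) * sqrt (3 / 2)"
    by (rule mult_left_mono[OF U_norm]) (use \<delta>_QT in simp)
  finally have T_norm: "spectral_norm T \<le> sqrt 2 * (1 + \<delta>_QT) * sqrt (3 / 2)" .
  have D_QT_norm: "spectral_norm D_QT \<le> \<delta>_QT * sqrt (3 / 2)"
    by (rule order_trans[OF D_QT_le mult_left_mono[OF U_norm]]) (use \<delta>_QT in simp)
  have "\<delta>_TS * (spectral_norm T * spectral_norm S)
      \<le> \<delta>_TS * ((sqrt 2 * (1 + \<delta>_QT) * sqrt (3 / 2)) * (sqrt 2 * (1 + \<delta>_US) * x))"
    by (intro mult_left_mono mult_mono T_norm S_norm spectral_norm_nonneg[OF S n])
      (use \<delta>_TS \<delta>_QT in auto)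
  then have D_TS_norm: "spectral_norm D_TS
      \<le> \<delta>_TS * ((sqrt 2 * (1 + \<delta>_QT) * sqrt (3 / 2)) * (sqrt 2 * (1 + \<delta>_US) * x))"
    using D_TS_le by (simp add: mult.assoc)

  \<comment> \<open>Expanding \<open>Q * (T * S + D_TS)\<close> with \<open>Q * T = U + D_QT\<close>
    and then \<open>U * S = X + D_US\<close> leaves exactly these three error terms.\<close>
  define D where "D = D_US + (D_QT * S + Q * D_TS)"
  have D: "D \<in> carrier_mat m n"
    using D_US D_QT S Q D_TS by (auto simp: D_def)
  have QTS: "Q * (T * S) = X + D_US + D_QT * S"
    using assoc_mult_mat[OF Q T S] add_mult_distrib_mat[OF U D_QT S] by (simp add: QT US)
  have "Q * R = Q * (T * S) + Q * D_TS"
    unfolding R by (rule mult_add_distrib_mat[OF Q _ D_TS]) (use T S in auto)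
  also have "\<dots> = X + D"
    unfolding QTS D_def using X D_US D_QT S Q D_TS by (intro eq_matI) auto
  finally have QR: "Q * R = X + D" .
  have "spectral_norm D \<le> (\<delta>_US + sqrt 6 * \<delta>_QT + 9 * \<delta>_TS
                             + 9 * (\<delta>_US + \<delta>_QT + \<delta>_TS)\<^sup>2) * x"
  proof (rule spectral_norm_leI[OF D n])
    fix v :: "real vec" assume v: "v \<in> carrier_vec n" "vnorm v = 1"
    \<comment> \<open>The factors are applied to a unit vector one after the other, so that vector
      inequalities stand in for the triangle inequality and submultiplicativity of the spectral
      norm.\<close>
    have "D *\<^sub>v v = D_US *\<^sub>v v + (D_QT * S + Q * D_TS) *\<^sub>v v"
      unfolding D_def by (rule add_mult_distrib_mat_vec[OF D_US _ v(1)]) (use D_QT S Q D_TS in auto)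
    also have "(D_QT * S + Q * D_TS) *\<^sub>v v = D_QT * S *\<^sub>v v + Q * D_TS *\<^sub>v v"
      by (rule add_mult_distrib_mat_vec[OF _ _ v(1)]) (use D_QT S Q D_TS in auto)
    also have "D_QT * S *\<^sub>v v = D_QT *\<^sub>v (S *\<^sub>v v)"
      by (rule assoc_mult_mat_vec[OF D_QT S v(1)])
    also have "Q * D_TS *\<^sub>v v = Q *\<^sub>v (D_TS *\<^sub>v v)"
      by (rule assoc_mult_mat_vec[OF Q D_TS v(1)])
    finally have Dv: "D *\<^sub>v v = D_US *\<^sub>v v + (D_QT *\<^sub>v (S *\<^sub>v v) + Q *\<^sub>v (D_TS *\<^sub>v v))" .
    have "vnorm (D *\<^sub>v v) \<le> vnorm (D_US *\<^sub>v v)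
        + (vnorm (D_QT *\<^sub>v (S *\<^sub>v v)) + vnorm (Q *\<^sub>v (D_TS *\<^sub>v v)))"
      unfolding Dv using carrier_matD(1)[OF D_US] carrier_matD(1)[OF D_QT] carrier_matD(1)[OF Q]
      by (intro order_trans[OF vnorm_triangle[of _ m]] add_left_mono vnorm_triangle[of _ m]
          carrier_vecI) simp_all
    moreover have "vnorm (D_US *\<^sub>v v) \<le> \<delta>_US * x"
      using vnorm_mult_le[OF D_US v(1)] D_US_le v(2) by (simp add: x_def)
    moreover have "vnorm (D_QT *\<^sub>v (S *\<^sub>v v)) \<le> (\<delta>_QT * sqrt (3 / 2)) * (sqrt 2 * (1 + \<delta>_US) * x)"
    proof -
      have Sv: "S *\<^sub>v v \<in> carrier_vec n" "vnorm (S *\<^sub>v v) \<le> sqrt 2 * (1 + \<delta>_US) * x"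
        using S v vnorm_mult_le[OF S v(1)] S_norm by auto
      have "vnorm (D_QT *\<^sub>v (S *\<^sub>v v)) \<le> spectral_norm D_QT * vnorm (S *\<^sub>v v)"
        by (rule vnorm_mult_le[OF D_QT Sv(1)])
      also have "\<dots> \<le> (\<delta>_QT * sqrt (3 / 2)) * (sqrt 2 * (1 + \<delta>_US) * x)"
        by (rule mult_mono[OF D_QT_norm Sv(2)]) (use \<delta>_QT in auto)
      finally show ?thesis .
    qed
    moreover have "vnorm (Q *\<^sub>v (D_TS *\<^sub>v v)) \<le> sqrt (3 / 2)
        * (\<delta>_TS * ((sqrt 2 * (1 + \<delta>_QT) * sqrt (3 / 2)) * (sqrt 2 * (1 + \<delta>_US) * x)))"
    proof -
      have Dv: "D_TS *\<^sub>v v \<in> carrier_vec n" "vnorm (D_TS *\<^sub>v v) \<le> spectral_norm D_TS"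
        using D_TS v vnorm_mult_le[OF D_TS v(1)] by auto
      have "vnorm (Q *\<^sub>v (D_TS *\<^sub>v v)) \<le> sqrt (3 / 2) * vnorm (D_TS *\<^sub>v v)"
        by (rule near_isometry_upper[OF Q Dv(1) Q_half])
      also have "\<dots> \<le> sqrt (3 / 2)
          * (\<delta>_TS * ((sqrt 2 * (1 + \<delta>_QT) * sqrt (3 / 2)) * (sqrt 2 * (1 + \<delta>_US) * x)))"
        by (rule mult_left_mono[OF order_trans[OF Dv(2) D_TS_norm]]) simp
      finally show ?thesis .
    qed
    ultimately have "vnorm (D *\<^sub>v v) \<le> \<delta>_US * x + ((\<delta>_QT * sqrt (3 / 2)) * (sqrt 2 * (1 + \<delta>_US) * x)
        + sqrt (3 / 2) * (\<delta>_TS * ((sqrt 2 * (1 + \<delta>_QT) * sqrt (3 / 2)) * (sqrt 2 * (1 + \<delta>_US) * x))))"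
      by linarith
    \<comment> \<open>Grouping the roots: \<open>sqrt (3 / 2) * sqrt 2\<close> is
      \<open>sqrt 3\<close>, and the two squares multiply to (3/2) * 2 = 3.\<close>
    also have "\<dots> = \<delta>_US * x + ((sqrt (3 / 2) * sqrt 2) * (\<delta>_QT * (1 + \<delta>_US) * x)
        + (sqrt (3 / 2) * sqrt (3 / 2)) * (sqrt 2 * sqrt 2) * (\<delta>_TS * (1 + \<delta>_QT) * (1 + \<delta>_US) * x))"
      by (simp only: mult_ac)
    also have "\<dots> = (\<delta>_US + sqrt 3 * (\<delta>_QT * (1 + \<delta>_US))
        + 3 * (\<delta>_TS * (1 + \<delta>_QT) * (1 + \<delta>_US))) * x"
      by (simp add: algebra_simps flip: real_sqrt_mult)
    also have "\<dots> \<le> (\<delta>_US + sqrt 6 * \<delta>_QT + 9 * \<delta>_TS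
                             + 9 * (\<delta>_US + \<delta>_QT + \<delta>_TS)\<^sup>2) * x"
      by (rule mult_right_mono[OF residual_coefficient_le x]) (use \<delta>_US \<delta>_QT \<delta>_TS in auto)
    finally show "vnorm (D *\<^sub>v v) \<le> (\<delta>_US + sqrt 6 * \<delta>_QT + 9 * \<delta>_TS
                             + 9 * (\<delta>_US + \<delta>_QT + \<delta>_TS)\<^sup>2) * x" .
  qed
  then show "spectral_norm (1\<^sub>m (p * s) - Q\<^sup>T * Q) \<le> 3 * \<omega>_Q \<and>
    (\<exists>D \<in> carrier_mat m (p * s). Q * R = X + D \<and>
       spectral_norm D \<le> (\<delta>_US + sqrt 6 * \<delta>_QT + 9 * \<delta>_TS
                             + 9 * (\<delta>_US + \<delta>_QT + \<delta>_TS)\<^sup>2) * spectral_norm X)"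
    using Q_3 D QR by (auto simp: n_def x_def)
qed

end
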